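(* Let $E_R(n)$ denote the expected value of the rank of the root of a (uniformly random) unlabeled rooted plane tree of size $n$. Then, as $n\to\infty$, $$E_R(n)\sim \sum_{k=1}^\infty \frac{9}{4^{1-k}+4+4^k}\approx 1.62297,$$ where $\approx$ gives the value of the sum rounded to five decimal places.
   Context: A tree means an unlabeled rooted plane tree (a finite rooted tree with at least one vertex in which the children of every vertex are linearly ordered), counted up to isomorphism; its size is its number of vertices. The random tree is uniform among all trees of size $n$. A leaf is a vertex with no children (so the root of the one-vertex tree is a leaf). The rank of a vertex is the length (number of edges) of a shortest downward path (parent to child steps) from the vertex to a leaf; leaves have rank $0$. Write $a_n\sim b_n$ if $\lim_{n\to\infty} a_n/b_n=1$. *)

theory Defs
  imports "HOL-Probability.Probability_Mass_Function" "HOL-Library.Landau_Symbols"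
begin

text \<open>
  A value of this type is an isomorphism class of unlabeled rooted plane trees: it is determined by
  the ordered list of the subtrees rooted at the children of the root. A vertex is represented by
  the subtree consisting of it and its descendants.
\<close>

datatype plane_tree = PNode (children: "plane_tree list")

text \<open>The generated size function of the datatype is not the number of vertices.\<close>

primrec num_vertices :: "plane_tree \<Rightarrow> nat" where
  "num_vertices (PNode ts) = 1 + sum_list (map num_vertices ts)"

definition is_leaf :: "plane_tree \<Rightarrow> bool" where
  "is_leaf t \<longleftrightarrow> children t = []"

definition child_step :: "plane_tree \<Rightarrow> plane_tree \<Rightarrow> bool" where
  "child_step t s \<longleftrightarrow> s \<in> set (children t)"

text \<open>
  \<open>(child_step ^^ k) t l\<close> says that a downward path of exactly \<open>k\<close> edges leads from the root of \<open>t\<close>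
  to a vertex whose subtree is \<open>l\<close>. Distinct vertices may have equal subtrees, but this
  does not affect the set of lengths of paths to leaves.
\<close>

definition root_rank :: "plane_tree \<Rightarrow> nat" where
  "root_rank t = (LEAST k. \<exists>l. is_leaf l \<and> (child_step ^^ k) t l)"

definition trees_of_size :: "nat \<Rightarrow> plane_tree set" where
  "trees_of_size n = {t. num_vertices t = n}"

text \<open>
  There is no tree of size \<open>0\<close>, so \<open>expected_root_rank n\<close> is meaningful only for \<open>n \<ge> 1\<close>.
\<close>

definition expected_root_rank :: "nat \<Rightarrow> real" where
  "expected_root_rank n =
     measure_pmf.expectation (pmf_of_set (trees_of_size n)) (\<lambda>t. real (root_rank t))"

definition rank_series_term :: "nat \<Rightarrow> real" where
  "rank_series_term k = 9 / (4 powi (1 - int k) + 4 + 4 ^ k)"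

end

theory Submission
  imports Defs "HOL-Analysis.Analysis" "HOL-Real_Asymp.Real_Asymp"
begin

text \<open>
  Let \<open>T\<^sub>k\<close> be the generating function of the trees of root rank at least \<open>k\<close>. Splitting off the
  leftmost subtree of the root gives \<open>T\<^sub>k\<^sub>+\<^sub>1 = T\<^sub>k (z + T\<^sub>k\<^sub>+\<^sub>1)\<close>, that is,
  \<open>T\<^sub>k\<^sub>+\<^sub>1 = z (T\<^sub>k + T\<^sub>k\<^sup>2 + \<dots>)\<close>, and \<open>T\<^sub>0 = z + T\<^sub>0\<^sup>2\<close>. The coefficients \<open>t\<^sub>n\<close> of \<open>T\<^sub>0\<close> are
  heavy-tailed: in a large product of such series one factor carries almost all of the size. So if
  \<open>[z\<^sup>n] T\<^sub>k \<sim> c\<^sub>k t\<^sub>n\<close>, then \<open>[z\<^sup>n] T\<^sub>k\<^sup>j \<sim> j T\<^sub>k(1/4)\<^sup>j\<^sup>-\<^sup>1 c\<^sub>k t\<^sub>n\<close>, with bounds that allow summation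
  over \<open>j\<close>. This yields \<open>c\<^sub>k\<^sub>+\<^sub>1 = c\<^sub>k / (4 (1 - T\<^sub>k(1/4))\<^sup>2)\<close>, where \<open>T\<^sub>k(1/4) = 3 / (2 (2 + 4\<^sup>k))\<close>,
  hence \<open>c\<^sub>k = 9 \<cdot> 4\<^sup>k / (2 + 4\<^sup>k)\<^sup>2\<close>. The expected rank is the sum over \<open>k \<ge> 1\<close> of
  \<open>[z\<^sup>n] T\<^sub>k / t\<^sub>n\<close>, and dominated convergence applies once more, since coefficientwise
  \<open>T\<^sub>k \<le> T\<^sub>0\<^sup>k\<^sup>+\<^sup>1\<close> and \<open>T\<^sub>0(1/4) = 1/2\<close>.
\<close>

section \<open>Nonnegative power series with heavy-tailed coefficients\<close>

text \<open>The value at 1, which becomes the singularity once the counting series are rescaled; it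
  is meaningful only for summable coefficients.\<close>

definition fps_total :: "real fps \<Rightarrow> real" where
  "fps_total A = (\<Sum>n. fps_nth A n)"

lemma
  fixes A B :: "real fps"
  assumes "\<And>n. 0 \<le> fps_nth A n" "summable (fps_nth A)"
    and "\<And>n. 0 \<le> fps_nth B n" "summable (fps_nth B)"
  shows summable_fps_mult: "summable (fps_nth (A * B))"
    and fps_total_mult: "fps_total (A * B) = fps_total A * fps_total B"
proof -
  have "(\<lambda>n. \<Sum>i\<le>n. fps_nth A i * fps_nth B (n - i)) sums (fps_total A * fps_total B)"
    unfolding fps_total_def using assms by (intro Cauchy_product_sums) simp_all
  then have "fps_nth (A * B) sums (fps_total A * fps_total B)"
    by (simp add: fps_mult_nth atLeast0AtMost cong: sums_cong)
  then show "summable (fps_nth (A * B))" "fps_total (A * B) = fps_total A * fps_total B"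
    by (simp_all add: sums_iff fps_total_def)
qed

lemma sum_le_fps_total:
  assumes "\<And>n. 0 \<le> fps_nth A n" "summable (fps_nth A)"
  shows "(\<Sum>i\<le>n. fps_nth A i) \<le> fps_total A"
  unfolding fps_total_def using assms by (intro sum_le_suminf) auto

lemma fps_mult_nth_mono:
  fixes A B C D :: "real fps"
  assumes "\<And>n. 0 \<le> fps_nth A n" "\<And>n. fps_nth A n \<le> fps_nth C n"
    and "\<And>n. 0 \<le> fps_nth B n" "\<And>n. fps_nth B n \<le> fps_nth D n"
  shows "fps_nth (A * B) n \<le> fps_nth (C * D) n"
  unfolding fps_mult_nth by (intro sum_mono mult_mono order_trans[OF assms(1,2)] assms)

lemma
  fixes A :: "real fps"
  assumes "\<And>n. 0 \<le> fps_nth A n"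
  shows fps_power_nth_nonneg: "0 \<le> fps_nth (A ^ m) n"
    and fps_total_power: "summable (fps_nth A) \<Longrightarrow> fps_total (A ^ m) = fps_total A ^ m"
proof -
  have nonneg: "0 \<le> fps_nth (A ^ m) n" for m n
    by (induction m arbitrary: n) (auto simp: fps_mult_nth intro!: sum_nonneg assms mult_nonneg_nonneg)
  then show "0 \<le> fps_nth (A ^ m) n" .
  have "fps_nth 1 = (\<lambda>n. if n = 0 then 1 else (0::real))"
    by (rule ext) simp
  then have 1: "fps_nth 1 sums (1::real)"
    using sums_single[of 0 "\<lambda>_. 1::real"] by simp
  have "summable (fps_nth (A ^ m)) \<and> fps_total (A ^ m) = fps_total A ^ m" if "summable (fps_nth A)"
  proof (induction m)
    case 0
    show ?case using 1 by (simp add: sums_iff fps_total_def del: fps_one_nth)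
  next
    case (Suc m)
    then show ?case
      using summable_fps_mult[OF assms that nonneg] fps_total_mult[OF assms that nonneg] by simp
  qed
  then show "summable (fps_nth A) \<Longrightarrow> fps_total (A ^ m) = fps_total A ^ m" by blast
qed

text \<open>The model is n^(-3/2), the decay of the rescaled Catalan numbers. Monotonicity of n^2
  \<open>w n\<close> and the ratio limit stand in for exact asymptotics.\<close>

locale heavy_tail =
  fixes w :: "nat \<Rightarrow> real"
  assumes w_0: "w 0 = 0"
    and w_pos: "0 < n \<Longrightarrow> 0 < w n"
    and w_summable: "summable w"
    and w_incr: "m \<le> n \<Longrightarrow> real m ^ 2 * w m \<le> real n ^ 2 * w n"
    and w_ratio: "(\<lambda>n. w n / w (Suc n)) \<longlonglongrightarrow> 1"
begin

lemma w_nonneg: "0 \<le> w n"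
  using w_0 w_pos[of n] by (cases "n = 0") auto

text \<open>Monotonicity of \<open>real n ^ 2 * w n\<close>, read as regularity at comparable
  scales.\<close>

lemma w_le:
  assumes "m \<le> n" "0 < m" "real n \<le> q * real m"
  shows "w m \<le> q\<^sup>2 * w n"
proof -
  have "real m ^ 2 * w m \<le> real n ^ 2 * w n"
    by (rule w_incr[OF assms(1)])
  also have "\<dots> \<le> (q * real m) ^ 2 * w n"
    using assms by (intro mult_right_mono power_mono w_nonneg) auto
  finally have "real m ^ 2 * w m \<le> real m ^ 2 * (q\<^sup>2 * w n)"
    by (simp add: power_mult_distrib mult_ac)
  then show ?thesis
    using assms(2) by simp
qed

lemma w_shift: "(\<lambda>n. w (n - i) / w n) \<longlonglongrightarrow> 1"
proof -
  \<comment> \<open>Shifting the denominator up avoids truncated subtraction in the induction; an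
    index offset then gives the claim.\<close>
  have "(\<lambda>n. w n / w (n + i)) \<longlonglongrightarrow> 1"
  proof (induction i)
    case 0
    have "\<forall>\<^sub>F n in sequentially. w n / w (n + 0) = 1"
      using eventually_gt_at_top[of "0::nat"] by eventually_elim (simp add: less_imp_neq[OF w_pos, symmetric])
    then show ?case by (rule tendsto_eventually)
  next
    case (Suc i)
    have "(\<lambda>n. w (n + i) / w (Suc (n + i))) \<longlonglongrightarrow> 1"
      by (rule LIMSEQ_ignore_initial_segment[OF w_ratio])
    from tendsto_mult[OF Suc this]
    have "(\<lambda>n. w n / w (n + i) * (w (n + i) / w (Suc (n + i)))) \<longlonglongrightarrow> 1" by simp
    moreover have "\<forall>\<^sub>F n in sequentially.
        w n / w (n + i) * (w (n + i) / w (Suc (n + i))) = w n / w (n + Suc i)"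
      using eventually_gt_at_top[of "0::nat"]
    proof eventually_elim
      case (elim n)
      then have "0 < w (n + i)" by (intro w_pos) auto
      then show ?case by simp
    qed
    ultimately show ?case
      by (rule Lim_transform_eventually)
  qed
  then have "(\<lambda>n. w (n + i - i) / w (n + i)) \<longlonglongrightarrow> 1" by simp
  then show ?thesis by (rule LIMSEQ_offset)
qed

section \<open>Products and powers of series dominated by a heavy-tailed sequence\<close>

definition dominated :: "real \<Rightarrow> real fps \<Rightarrow> bool" where
  "dominated C A \<longleftrightarrow> (\<forall>n. 0 \<le> fps_nth A n \<and> fps_nth A n \<le> C * w n)"

lemma dominatedD:
  assumes "dominated C A"
  shows "0 \<le> fps_nth A n" "fps_nth A n \<le> C * w n"
  using assms by (auto simp: dominated_def)

lemma dominated_const_nonneg: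
  assumes "dominated C A"
  shows "0 \<le> C"
proof -
  have "0 \<le> C * w 1" using dominatedD[OF assms, of 1] by linarith
  then show ?thesis using w_pos[of 1] by (simp add: zero_le_mult_iff)
qed

lemma dominated_summable: "dominated C A \<Longrightarrow> summable (fps_nth A)"
  using summable_comparison_test'[OF summable_mult[OF w_summable, of C], of 0 "fps_nth A"]
  by (simp add: dominated_def)

lemma fps_total_nonneg: "dominated C A \<Longrightarrow> 0 \<le> fps_total A"
  unfolding fps_total_def by (intro suminf_nonneg dominated_summable) (auto dest: dominatedD)

text \<open>
  Of \<open>m + 2\<close> summands of \<open>n\<close> either the first is at least \<open>n / (m + 2)\<close> or the sum of the others
  is at least \<open>(m + 1) n / (m + 2)\<close>; at such indices \<open>w\<close> is bounded by a multiple of \<open>w n\<close>.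
\<close>

lemma dominated_power:
  assumes A: "dominated C A"
  shows "dominated (C * (real m + 1) ^ 3 * fps_total A ^ m) (A ^ Suc m)"
proof (induction m)
  case 0
  show ?case using A by simp
next
  case (Suc m)
  let ?S = "fps_total A" and ?D = "C * (real m + 1) ^ 3 * fps_total A ^ m"
  let ?B = "A ^ Suc m"
  note B = Suc.IH
  have S: "0 \<le> ?S" and C: "0 \<le> C" and D: "0 \<le> ?D"
    using fps_total_nonneg[OF A] dominated_const_nonneg[OF A] dominated_const_nonneg[OF B] by blast+
  define q where "q = (real m + 2) / (real m + 1)"
  \<comment> \<open>Both case bounds are nonnegative, so their sum serves for every \<open>i\<close>
    and the convolution need not be split.\<close>
  have Aw: "fps_nth A i * fps_nth ?B (n - i) \<le>
      C * (real m + 2) ^ 2 * w n * fps_nth ?B (n - i) + fps_nth A i * (?D * q\<^sup>2 * w n)"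
    if "i \<le> n" for i n
  proof (cases "n = 0")
    case True
    have "fps_nth A 0 = 0" using dominatedD[OF A, of 0] w_0 by simp
    then show ?thesis using that True w_0 by simp
  next
    case False
    show ?thesis
    proof (cases "n \<le> (m + 2) * i")
      case True
      have "real n \<le> (real m + 2) * real i"
        using True by (metis (mono_tags, lifting) of_nat_add of_nat_le_iff of_nat_mult of_nat_numeral)
      then have "w i \<le> (real m + 2) ^ 2 * w n"
        using True False that by (intro w_le) (auto intro: Nat.gr0I)
      then have "fps_nth A i \<le> C * ((real m + 2) ^ 2 * w n)"
        using order_trans[OF dominatedD(2)[OF A, of i] mult_left_mono[OF _ C]] by blast
      then have "fps_nth A i * fps_nth ?B (n - i) \<le> C * ((real m + 2) ^ 2 * w n) * fps_nth ?B (n - i)"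
        by (rule mult_right_mono) (rule dominatedD[OF B])
      moreover have "0 \<le> fps_nth A i * (?D * q\<^sup>2 * w n)"
        by (rule mult_nonneg_nonneg[OF dominatedD(1)[OF A] mult_nonneg_nonneg[OF _ w_nonneg]])
          (rule mult_nonneg_nonneg[OF D], simp)
      ultimately show ?thesis by (simp add: mult.assoc)
    next
      case less: False
      have "real n > (real m + 2) * real i"
        using less by (metis (mono_tags, lifting) not_le of_nat_add of_nat_less_iff of_nat_mult of_nat_numeral)
      then have "real n \<le> q * real (n - i)"
        using that by (simp add: q_def field_simps of_nat_diff)
      moreover have "i < n"
        using less by (simp add: not_le)
      ultimately have "w (n - i) \<le> q\<^sup>2 * w n"
        by (intro w_le) auto
      then have "fps_nth ?B (n - i) \<le> ?D * (q\<^sup>2 * w n)"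
        using order_trans[OF dominatedD(2)[OF B, of "n - i"] mult_left_mono[OF _ D]] by blast
      then have "fps_nth A i * fps_nth ?B (n - i) \<le> fps_nth A i * (?D * (q\<^sup>2 * w n))"
        by (rule mult_left_mono) (rule dominatedD[OF A])
      moreover have "0 \<le> C * (real m + 2) ^ 2 * w n * fps_nth ?B (n - i)"
        by (rule mult_nonneg_nonneg[OF mult_nonneg_nonneg[OF _ w_nonneg] dominatedD(1)[OF B]])
          (rule mult_nonneg_nonneg[OF C], simp)
      ultimately show ?thesis by (simp add: mult.assoc)
    qed
  qed
  have "fps_nth (A * ?B) n \<le> C * (real m + 2) ^ 3 * ?S ^ Suc m * w n" for n
  proof -
    have "fps_nth (A * ?B) n \<le> (\<Sum>i\<le>n. C * (real m + 2) ^ 2 * w n * fps_nth ?B (n - i)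
        + fps_nth A i * (?D * q\<^sup>2 * w n))"
      unfolding fps_mult_nth atLeast0AtMost by (rule sum_mono) (use Aw in auto)
    also have "\<dots> = C * (real m + 2) ^ 2 * w n * (\<Sum>i\<le>n. fps_nth ?B i)
        + (\<Sum>i\<le>n. fps_nth A i) * (?D * q\<^sup>2 * w n)"
      unfolding sum.distrib sum_distrib_left[symmetric] sum_distrib_right[symmetric]
      using sum.nat_diff_reindex[of "fps_nth ?B" "Suc n"] by (simp add: lessThan_Suc_atMost)
    also have "\<dots> \<le> C * (real m + 2) ^ 2 * w n * ?S ^ Suc m + ?S * (?D * q\<^sup>2 * w n)"
    proof (intro add_mono mult_left_mono mult_right_mono)
      show "(\<Sum>i\<le>n. fps_nth ?B i) \<le> ?S ^ Suc m"
        using sum_le_fps_total[OF dominatedD(1)[OF B] dominated_summable[OF B]]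
          fps_total_power[OF dominatedD(1)[OF A] dominated_summable[OF A]] by metis
      show "(\<Sum>i\<le>n. fps_nth A i) \<le> ?S"
        by (rule sum_le_fps_total[OF dominatedD(1)[OF A] dominated_summable[OF A]])
    qed (use C D S w_nonneg in \<open>simp_all del: power_Suc\<close>)
    also have "\<dots> = C * ?S ^ Suc m * w n * ((real m + 2) ^ 2 + (real m + 1) ^ 3 * q\<^sup>2)"
      by (simp add: algebra_simps)
    \<comment> \<open>The cube reproduces itself: \<open>q\<close> cancels two factors m + 1, and (m
      + 2)^2 (1 + (m + 1)) = (m + 2)^3.\<close>
    also have "(real m + 1) ^ 3 * q\<^sup>2 = (real m + 1) * (real m + 2) ^ 2"
      by (simp add: q_def power_divide power3_eq_cube power2_eq_square)
    also have "(real m + 2) ^ 2 + (real m + 1) * (real m + 2) ^ 2 = (real m + 2) ^ 3"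
      by (simp add: power3_eq_cube power2_eq_square algebra_simps)
    finally show ?thesis by (simp add: mult_ac)
  qed
  then show ?case
    using fps_power_nth_nonneg[OF dominatedD(1)[OF A], of "Suc (Suc m)"]
    by (simp add: dominated_def add_ac)
qed

text \<open>Dominated convergence in \<open>i\<close>: for fixed \<open>i\<close> the quotient
  \<open>w (n - i) / w n\<close> tends to 1, and \<open>2 * i \<le> n\<close> keeps
  \<open>n - i\<close> large enough for the summable bound \<open>fps_nth A i * (4 * D)\<close>. The
  predicate \<open>R\<close> is left open so that a weak and a strict half are both
  instances.\<close>

lemma half_convolution_tendsto:
  assumes A: "dominated C A" and B: "dominated D B"
    and lim: "(\<lambda>n. fps_nth B n / w n) \<longlonglongrightarrow> \<beta>"
    and R: "\<And>n i. R n i \<Longrightarrow> 2 * i \<le> n" "\<And>i. \<forall>\<^sub>F n in sequentially. R n i"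
  shows "(\<lambda>n. (\<Sum>i | i \<le> n \<and> R n i. fps_nth A i * fps_nth B (n - i)) / w n) \<longlonglongrightarrow> fps_total A * \<beta>"
proof -
  define g where "g i n = (if i \<le> n \<and> R n i then fps_nth A i * fps_nth B (n - i) / w n else 0)" for i n
  have A0: "fps_nth A 0 = 0"
    using dominatedD[OF A, of 0] w_0 by simp
  have "(g i \<longlongrightarrow> fps_nth A i * \<beta>) sequentially" for i
  proof -
    have "(\<lambda>n. fps_nth A i * ((fps_nth B (n - i) / w (n - i)) * (w (n - i) / w n))) \<longlonglongrightarrow> fps_nth A i * (\<beta> * 1)"
      by (intro tendsto_intros w_shift filterlim_compose[OF lim] filterlim_minus_const_nat_at_top)
    moreover have "\<forall>\<^sub>F n in sequentially. fps_nth A i * ((fps_nth B (n - i) / w (n - i)) * (w (n - i) / w n)) = g i n"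
      using R(2)[of i] eventually_gt_at_top[of i]
    proof eventually_elim
      case (elim n)
      then have "w (n - i) > 0" by (intro w_pos) auto
      then show ?case using elim by (simp add: g_def)
    qed
    ultimately show ?thesis
      by (simp add: Lim_transform_eventually)
  qed
  moreover have "\<forall>\<^sub>F (i, n) in at_top \<times>\<^sub>F sequentially. norm (g i n) \<le> fps_nth A i * (4 * D)"
  proof (intro always_eventually allI, clarify)
    fix i n
    show "norm (g i n) \<le> fps_nth A i * (4 * D)"
    proof (cases "i \<le> n \<and> R n i \<and> n > 0")
      case True
      then have "2 * i \<le> n" using R(1) by blast
      then have "w (n - i) \<le> 2 ^ 2 * w n"
        using True by (intro w_le) auto
      then have "fps_nth B (n - i) \<le> D * (2 ^ 2 * w n)"
        using order_trans[OF dominatedD(2)[OF B, of "n - i"] mult_left_mono[OF _ dominated_const_nonneg[OF B]]]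
        by blast
      then have "fps_nth B (n - i) / w n \<le> 4 * D"
        using w_pos[of n] True by (simp add: field_simps)
      then have "fps_nth A i * (fps_nth B (n - i) / w n) \<le> fps_nth A i * (4 * D)"
        by (rule mult_left_mono) (rule dominatedD[OF A])
      then show ?thesis
        using True dominatedD(1)[OF A] dominatedD(1)[OF B] w_nonneg by (simp add: g_def)
    next
      case False
      then show ?thesis
        using dominatedD(1)[OF A, of i] dominated_const_nonneg[OF B] A0 by (auto simp: g_def)
    qed
  qed
  moreover have "summable (\<lambda>i. fps_nth A i * (4 * D))"
    by (rule summable_mult2[OF dominated_summable[OF A]])
  ultimately have "(\<lambda>n. \<Sum>i. g i n) \<longlonglongrightarrow> (\<Sum>i. fps_nth A i * \<beta>)"
    by (intro conjunct2[OF conjunct2[OF tannerys_theorem]]) auto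
  moreover have "(\<Sum>i. g i n) = (\<Sum>i | i \<le> n \<and> R n i. fps_nth A i * fps_nth B (n - i)) / w n" for n
  proof -
    have "(\<Sum>i. g i n) = (\<Sum>i | i \<le> n \<and> R n i. g i n)"
      by (rule suminf_finite) (auto simp: g_def)
    then show ?thesis by (simp add: g_def sum_divide_distrib)
  qed
  ultimately show ?thesis
    by (simp add: fps_total_def suminf_mult2[OF dominated_summable[OF A]])
qed

lemma mult_tendsto:
  assumes A: "dominated C A" and B: "dominated D B"
    and a: "(\<lambda>n. fps_nth A n / w n) \<longlonglongrightarrow> \<alpha>" and b: "(\<lambda>n. fps_nth B n / w n) \<longlonglongrightarrow> \<beta>"
  shows "(\<lambda>n. fps_nth (A * B) n / w n) \<longlonglongrightarrow> fps_total A * \<beta> + fps_total B * \<alpha>"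
proof -
  have ev: "\<forall>\<^sub>F n in sequentially. 2 * i \<le> n" "\<forall>\<^sub>F n in sequentially. 2 * i < n" for i :: nat
    by (rule eventually_ge_at_top eventually_gt_at_top)+
  \<comment> \<open>One half is reflected by i -> n - i; with one inequality weak and the other
    strict, the middle index is counted once.\<close>
  have "fps_nth (A * B) n = (\<Sum>i | i \<le> n \<and> 2 * i \<le> n. fps_nth A i * fps_nth B (n - i))
      + (\<Sum>i | i \<le> n \<and> 2 * i < n. fps_nth B i * fps_nth A (n - i))" for n
  proof -
    have "(\<Sum>i | i \<le> n \<and> 2 * i < n. fps_nth B i * fps_nth A (n - i)) =
       (\<Sum>i | i \<le> n \<and> \<not> 2 * i \<le> n. fps_nth A i * fps_nth B (n - i))"
      by (rule sum.reindex_bij_witness[of _ "\<lambda>i. n - i" "\<lambda>i. n - i"]) auto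
    moreover have "(\<Sum>i | i \<le> n \<and> 2 * i \<le> n. fps_nth A i * fps_nth B (n - i))
        + (\<Sum>i | i \<le> n \<and> \<not> 2 * i \<le> n. fps_nth A i * fps_nth B (n - i)) =
        (\<Sum>i\<le>n. fps_nth A i * fps_nth B (n - i))"
      by (subst sum.union_disjoint[symmetric]) (auto intro: sum.cong)
    ultimately show ?thesis
      by (simp add: fps_mult_nth atLeast0AtMost)
  qed
  moreover have "(\<lambda>n. (\<Sum>i | i \<le> n \<and> 2 * i \<le> n. fps_nth A i * fps_nth B (n - i)) / w n
      + (\<Sum>i | i \<le> n \<and> 2 * i < n. fps_nth B i * fps_nth A (n - i)) / w n)
      \<longlonglongrightarrow> fps_total A * \<beta> + fps_total B * \<alpha>"
    by (intro tendsto_add half_convolution_tendsto[OF A B b] half_convolution_tendsto[OF B A a] ev) auto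
  ultimately show ?thesis
    by (simp add: add_divide_distrib)
qed

text \<open>The product rule of \<open>mult_tendsto\<close> iterates like the derivative of a
  power.\<close>

lemma power_tendsto:
  assumes A: "dominated C A" and a: "(\<lambda>n. fps_nth A n / w n) \<longlonglongrightarrow> \<alpha>"
  shows "(\<lambda>n. fps_nth (A ^ Suc m) n / w n) \<longlonglongrightarrow> real (Suc m) * fps_total A ^ m * \<alpha>"
proof (induction m)
  case 0
  then show ?case using a by simp
next
  case (Suc m)
  have "fps_total (A ^ Suc m) = fps_total A ^ Suc m"
    by (rule fps_total_power[OF dominatedD(1)[OF A] dominated_summable[OF A]])
  with mult_tendsto[OF A dominated_power[OF A] a Suc] show ?case
    by (simp add: algebra_simps)
qed

end

section \<open>Counting trees by root rank\<close>

text \<open>Guarantees that the \<open>LEAST\<close> in \<open>root_rank\<close> is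
  attained.\<close>

lemma ex_path_to_leaf: "\<exists>k l. is_leaf l \<and> (child_step ^^ k) t l"
proof (induction t)
  case (PNode ts)
  show ?case
  proof (cases ts)
    case Nil
    then show ?thesis by (intro exI[of _ 0] exI[of _ "PNode ts"]) (simp add: is_leaf_def)
  next
    case (Cons s ss)
    then obtain k l where "is_leaf l" "(child_step ^^ k) s l"
      using PNode[of s] by auto
    moreover have "child_step (PNode ts) s"
      by (simp add: child_step_def Cons)
    ultimately have "is_leaf l \<and> (child_step ^^ Suc k) (PNode ts) l"
      by (blast intro: relpowp_Suc_I2)
    then show ?thesis by blast
  qed
qed

lemma le_root_rank_iff:
  "k \<le> root_rank t \<longleftrightarrow> (\<forall>j<k. \<forall>l. is_leaf l \<longrightarrow> \<not> (child_step ^^ j) t l)"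
proof
  assume "k \<le> root_rank t"
  then show "\<forall>j<k. \<forall>l. is_leaf l \<longrightarrow> \<not> (child_step ^^ j) t l"
    unfolding root_rank_def using not_less_Least by (metis (lifting) less_le_trans)
next
  assume *: "\<forall>j<k. \<forall>l. is_leaf l \<longrightarrow> \<not> (child_step ^^ j) t l"
  have "\<exists>l. is_leaf l \<and> (child_step ^^ root_rank t) t l"
    unfolding root_rank_def by (rule LeastI_ex[OF ex_path_to_leaf])
  with * show "k \<le> root_rank t"
    using not_le by blast
qed

lemma Suc_le_root_rank_iff:
  "Suc k \<le> root_rank t \<longleftrightarrow> \<not> is_leaf t \<and> (\<forall>s\<in>set (children t). k \<le> root_rank s)"
proof -
  have *: "(child_step ^^ Suc j) t l \<longleftrightarrow> (\<exists>s\<in>set (children t). (child_step ^^ j) s l)" for j l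
    by (auto simp: relpowp_Suc_left child_step_def simp del: relpowp.simps)
  show ?thesis
    \<comment> \<open>\<open>All_less_Suc2\<close> isolates the path of length 0, which says that
      \<open>t\<close> itself is no leaf; longer paths enter a child first.\<close>
    unfolding le_root_rank_iff All_less_Suc2 * by auto
qed

lemma num_vertices_pos [simp]: "0 < num_vertices t"
  by (cases t) simp

text \<open>Descending through first children meets a new vertex at each level. The bound later
  truncates the sum over ranks.\<close>

lemma less_num_vertices: "k \<le> root_rank t \<Longrightarrow> k < num_vertices t"
proof (induction k arbitrary: t)
  case (Suc k)
  then have "\<not> is_leaf t" "\<forall>s\<in>set (children t). k \<le> root_rank s"
    by (simp_all add: Suc_le_root_rank_iff)
  then obtain s ss where t: "t = PNode (s # ss)" "k \<le> root_rank s"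
    by (cases t; cases "children t") (auto simp: is_leaf_def)
  then show ?case
    using Suc.IH[of s] by (simp add: t)
qed simp

section \<open>Decomposition of trees by the leftmost subtree\<close>

definition trees_of_rank_ge :: "nat \<Rightarrow> nat \<Rightarrow> plane_tree set" where
  "trees_of_rank_ge k n = {t. num_vertices t = n \<and> k \<le> root_rank t}"

lemma trees_of_rank_ge_0: "trees_of_rank_ge 0 n = trees_of_size n"
  by (simp add: trees_of_rank_ge_def trees_of_size_def)

lemma trees_of_rank_ge_size_0 [simp]: "trees_of_rank_ge k 0 = {}"
  by (auto simp: trees_of_rank_ge_def dest: arg_cong[where f = "(<) 0"])

lemma trees_of_size_unfold:
  "trees_of_size n = (if n = 1 then {PNode []} else {}) \<union> trees_of_rank_ge 1 n"
proof -
  have "t = PNode [] \<and> num_vertices t = 1" if "children t = []" for t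
    using that by (cases t) simp
  then show ?thesis
    using Suc_le_root_rank_iff[of 0]
    by (auto simp: trees_of_size_def trees_of_rank_ge_def is_leaf_def)
qed

text \<open>Inverse of splitting off the leftmost subtree: the first tree becomes the new first
  child of the root of the second, so sizes add.\<close>

definition graft :: "plane_tree \<times> plane_tree \<Rightarrow> plane_tree" where
  "graft p = PNode (fst p # children (snd p))"

lemma inj_graft: "inj graft"
  by (rule injI) (auto simp: graft_def prod_eq_iff intro: plane_tree.expand)

text \<open>Without its leftmost subtree, the root is a bare vertex or still has only children of
  rank at least \<open>k\<close>; the bare vertex has rank 0 and so needs its own
  alternative.\<close>

lemma trees_of_rank_ge_Suc:
  "trees_of_rank_ge (Suc k) n = graft ` (\<Union>i\<le>n. trees_of_rank_ge k i \<times>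
     ((if n - i = 1 then {PNode []} else {}) \<union> trees_of_rank_ge (Suc k) (n - i)))"
    (is "_ = ?R")
proof (intro equalityI subsetI)
  fix t assume "t \<in> trees_of_rank_ge (Suc k) n"
  then have n: "num_vertices t = n" and "\<not> is_leaf t"
    and *: "\<forall>s\<in>set (children t). k \<le> root_rank s"
    by (auto simp: trees_of_rank_ge_def Suc_le_root_rank_iff)
  then obtain s ss where t: "t = PNode (s # ss)"
    by (cases t; cases "children t") (auto simp: is_leaf_def)
  have sz: "num_vertices (PNode ss) = n - num_vertices s" "num_vertices s \<le> n"
    using n by (auto simp: t)
  have "PNode ss = PNode [] \<or> Suc k \<le> root_rank (PNode ss)"
    using * by (auto simp: Suc_le_root_rank_iff is_leaf_def t)
  then have "(s, PNode ss) \<in> (\<Union>i\<le>n. trees_of_rank_ge k i \<times>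
     ((if n - i = 1 then {PNode []} else {}) \<union> trees_of_rank_ge (Suc k) (n - i)))"
    using sz * by (auto simp: trees_of_rank_ge_def t intro!: bexI[of _ "num_vertices s"])
  moreover have "t = graft (s, PNode ss)"
    by (simp add: graft_def t)
  ultimately show "t \<in> ?R" by blast
next
  fix t assume "t \<in> ?R"
  then obtain i s u where i: "i \<le> n" and s: "s \<in> trees_of_rank_ge k i"
    and u: "u \<in> (if n - i = 1 then {PNode []} else {}) \<union> trees_of_rank_ge (Suc k) (n - i)"
    and t: "t = graft (s, u)"
    by auto
  have "num_vertices t = num_vertices s + num_vertices u"
    by (cases u) (simp add: t graft_def)
  moreover have "num_vertices u = n - i"
    using u by (auto simp: trees_of_rank_ge_def split: if_splits)
  moreover have "\<forall>x\<in>set (children u). k \<le> root_rank x"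
    using u by (auto simp: trees_of_rank_ge_def Suc_le_root_rank_iff split: if_splits)
  ultimately show "t \<in> trees_of_rank_ge (Suc k) n"
    using i s by (auto simp: trees_of_rank_ge_def t graft_def is_leaf_def Suc_le_root_rank_iff)
qed

lemma finite_trees_of_size: "finite (trees_of_size n)"
proof (induction n rule: less_induct)
  case (less n)
  have fin: "finite (trees_of_rank_ge k i)" if "i < n" for i k
    using less[OF that] by (rule finite_subset[rotated])
      (auto simp: trees_of_rank_ge_def trees_of_size_def)
  have "finite (trees_of_rank_ge 0 i \<times>
     ((if n - i = 1 then {PNode []} else {}) \<union> trees_of_rank_ge (Suc 0) (n - i)))" (is "finite (?P i)")
    if le: "i \<le> n" for i
  proof -
    \<comment> \<open>No tree has size 0, so the left factor is empty at \<open>i = 0\<close> and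
      the right one at \<open>i = n\<close>; only sizes below \<open>n\<close> remain.\<close>
    consider "i = 0" | "0 < i" "i < n" | "0 < i" "i = n"
      using le by linarith
    then show ?thesis
    proof cases
      case 1
      then show ?thesis by simp
    next
      case 2
      then show ?thesis using fin by auto
    next
      case 3
      then show ?thesis by simp
    qed
  qed
  then have "finite (graft ` (\<Union>i\<le>n. ?P i))"
    by auto
  then have "finite (trees_of_rank_ge (Suc 0) n)"
    by (simp only: trees_of_rank_ge_Suc[symmetric])
  then show ?case
    by (simp add: trees_of_size_unfold)
qed

lemma finite_trees_of_rank_ge: "finite (trees_of_rank_ge k n)"
  using finite_trees_of_size[of n] by (rule finite_subset[rotated])
    (auto simp: trees_of_rank_ge_def trees_of_size_def)

lemma card_trees_of_rank_ge_Suc: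
  "card (trees_of_rank_ge (Suc k) n) = (\<Sum>i\<le>n. card (trees_of_rank_ge k i) *
     ((if n - i = 1 then 1 else 0) + card (trees_of_rank_ge (Suc k) (n - i))))"
proof -
  let ?B = "\<lambda>m. (if m = 1 then {PNode []} else {}) \<union> trees_of_rank_ge (Suc k) m"
  have fin: "finite (?B m)" for m
    by (simp add: finite_trees_of_rank_ge)
  have "PNode [] \<notin> trees_of_rank_ge (Suc k) m" for m
    by (simp add: trees_of_rank_ge_def Suc_le_root_rank_iff is_leaf_def)
  then have B: "card (?B m) = (if m = 1 then 1 else 0) + card (trees_of_rank_ge (Suc k) m)" for m
    by (simp add: finite_trees_of_rank_ge)
  have "card (trees_of_rank_ge (Suc k) n) = card (\<Union>i\<le>n. trees_of_rank_ge k i \<times> ?B (n - i))"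
    unfolding trees_of_rank_ge_Suc[of k n]
    by (rule card_image) (rule inj_on_subset[OF inj_graft], simp)
  also have "\<dots> = (\<Sum>i\<le>n. card (trees_of_rank_ge k i \<times> ?B (n - i)))"
    by (rule card_UN_disjoint)
       (use fin finite_trees_of_rank_ge in \<open>auto simp: trees_of_rank_ge_def\<close>)
  finally show ?thesis
    by (simp only: card_cartesian_product B)
qed

text \<open>The substitution \<open>z \<mapsto> z / 4\<close> normalises the radius of convergence to \<open>1\<close>.\<close>

definition rank_gf :: "nat \<Rightarrow> real fps" where
  "rank_gf k = Abs_fps (\<lambda>n. card (trees_of_rank_ge k n) / 4 ^ n)"

lemma rank_gf_nth: "fps_nth (rank_gf k) n = card (trees_of_rank_ge k n) / 4 ^ n"
  by (simp add: rank_gf_def)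

lemma rank_gf_nonneg [simp]: "0 \<le> fps_nth (rank_gf k) n"
  by (simp add: rank_gf_nth)

lemma rank_gf_nth_0 [simp]: "fps_nth (rank_gf k) 0 = 0"
  by (simp add: rank_gf_nth)

text \<open>The term \<open>fps_const (1/4) * fps_X\<close> stands for the bare root left when the
  split-off subtree was the only one.\<close>

lemma rank_gf_Suc: "rank_gf (Suc k) = rank_gf k * (fps_const (1/4) * fps_X + rank_gf (Suc k))"
proof (rule fps_ext)
  fix n
  have X: "fps_nth (fps_const (1/4) * fps_X + rank_gf (Suc k)) m =
      ((if m = 1 then 1 else 0) + card (trees_of_rank_ge (Suc k) m)) / 4 ^ m" for m
    by (simp add: rank_gf_nth field_simps)
  have "fps_nth (rank_gf (Suc k)) n = (\<Sum>i\<le>n. real (card (trees_of_rank_ge k i)) *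
     ((if n - i = 1 then 1 else 0) + card (trees_of_rank_ge (Suc k) (n - i)))) / 4 ^ n"
    unfolding rank_gf_nth card_trees_of_rank_ge_Suc[of k n] by (simp add: of_nat_sum)
  also have "\<dots> = (\<Sum>i\<le>n. fps_nth (rank_gf k) i *
      fps_nth (fps_const (1/4) * fps_X + rank_gf (Suc k)) (n - i))"
    unfolding sum_divide_distrib X rank_gf_nth
    by (rule sum.cong) (auto simp: power_add[symmetric])
  also have "\<dots> = fps_nth (rank_gf k * (fps_const (1/4) * fps_X + rank_gf (Suc k))) n"
    by (simp add: fps_mult_nth atLeast0AtMost)
  finally show "fps_nth (rank_gf (Suc k)) n = \<dots>" .
qed

lemma rank_gf_0: "rank_gf 0 = fps_const (1/4) * fps_X + rank_gf 1"
proof (rule fps_ext)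
  fix n
  have "PNode [] \<notin> trees_of_rank_ge 1 m" for m
    using Suc_le_root_rank_iff[of 0] by (simp add: trees_of_rank_ge_def is_leaf_def)
  then have "card (trees_of_rank_ge 0 n) = (if n = 1 then 1 else 0) + card (trees_of_rank_ge 1 n)"
    unfolding trees_of_rank_ge_0 trees_of_size_unfold[of n] by (simp add: finite_trees_of_rank_ge)
  then show "fps_nth (rank_gf 0) n = fps_nth (fps_const (1/4) * fps_X + rank_gf 1) n"
    by (simp add: rank_gf_nth field_simps)
qed

section \<open>Coefficient asymptotics\<close>

lemma rank_gf_le_0: "fps_nth (rank_gf k) n \<le> fps_nth (rank_gf 0) n"
proof -
  have "trees_of_rank_ge k n \<subseteq> trees_of_rank_ge 0 n"
    by (auto simp: trees_of_rank_ge_def)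
  then show ?thesis
    by (simp add: rank_gf_nth card_mono[OF finite_trees_of_rank_ge] divide_right_mono)
qed

lemma rank_gf_0_quadratic: "rank_gf 0 = fps_const (1/4) * fps_X + rank_gf 0 ^ 2"
  using rank_gf_Suc[of 0] rank_gf_0 by (simp add: power2_eq_square)

text \<open>Differentiating F = z/4 + F^2 gives F' (1 - 2F) = 1/4, and the equation itself says (1 -
  2F)^2 = 1 - z. Hence (1 - z) F' = (1 - 2F)/4, whose coefficients yield the Catalan
  recurrence.\<close>

lemma rank_gf_0_nth_Suc:
  "real (Suc n) * fps_nth (rank_gf 0) (Suc n) =
     (if n = 0 then 1 / 4 else (real n - 1 / 2) * fps_nth (rank_gf 0) n)"
proof -
  define F where "F = rank_gf 0"
  have q: "F = fps_const (1/4) * fps_X + F ^ 2"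
    unfolding F_def by (rule rank_gf_0_quadratic)
  have "fps_deriv F = fps_deriv (fps_const (1/4) * fps_X + F ^ 2)"
    by (rule arg_cong[OF q])
  then have d: "fps_deriv F * (1 - 2 * F) = fps_const (1/4)"
    by (simp add: power2_eq_square algebra_simps)
  have c: "4 * fps_const (1/4) = (1 :: real fps)"
    by (simp add: numeral_fps_const)
  have "4 * F = 4 * (fps_const (1/4) * fps_X + F ^ 2)"
    by (rule arg_cong[OF q])
  also have "\<dots> = fps_X + 4 * F ^ 2"
    using c by (simp add: distrib_left mult.assoc[symmetric])
  finally have "(1 - 2 * F) ^ 2 = 1 - fps_X"
    by (simp add: power2_eq_square algebra_simps)
  then have "fps_deriv F * (1 - fps_X) = fps_const (1/4) * (1 - 2 * F)"
    using d by (metis mult.assoc power2_eq_square)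
  then have "fps_nth (fps_deriv F * (1 - fps_X)) n = fps_nth (fps_const (1/4) * (1 - 2 * F)) n"
    by simp
  then show ?thesis
    by (cases n) (simp_all add: F_def algebra_simps numeral_fps_const)
qed

lemma rank_gf_0_pos: "0 < n \<Longrightarrow> 0 < fps_nth (rank_gf 0) n"
proof (induction n)
  case (Suc n)
  then have "0 < real (Suc n) * fps_nth (rank_gf 0) (Suc n)"
    unfolding rank_gf_0_nth_Suc by auto
  then show ?case by (simp add: zero_less_mult_iff)
qed simp

text \<open>A telescoping form of the recurrence. The subtracted term is nonnegative, so the partial
  sums stay below 1/2 and the series converges at its singularity.\<close>

lemma sum_rank_gf_0:
  "(\<Sum>i\<le>Suc n. fps_nth (rank_gf 0) i) = 1 / 2 - (2 * real n + 1) * fps_nth (rank_gf 0) (Suc n)"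
proof (induction n)
  case 0
  show ?case using rank_gf_0_nth_Suc[of 0] by simp
next
  case (Suc n)
  show ?case
    using rank_gf_0_nth_Suc[of "Suc n"] by (simp add: Suc.IH sum.atMost_Suc[of _ "Suc n"] del: sum.atMost_Suc) (simp add: algebra_simps)
qed

interpretation rank_gf: heavy_tail "fps_nth (rank_gf 0)"
proof
  show "fps_nth (rank_gf 0) 0 = 0" by simp
  show "0 < n \<Longrightarrow> 0 < fps_nth (rank_gf 0) n" for n by (rule rank_gf_0_pos)
  show "summable (fps_nth (rank_gf 0))"
  proof (rule summableI_nonneg_bounded)
    fix n
    have "(\<Sum>i<n. fps_nth (rank_gf 0) i) \<le> (\<Sum>i\<le>Suc n. fps_nth (rank_gf 0) i)"
      by (rule sum_mono2) auto
    also have "\<dots> \<le> 1 / 2"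
      unfolding sum_rank_gf_0 by simp
    finally show "(\<Sum>i<n. fps_nth (rank_gf 0) i) \<le> 1 / 2" .
  qed simp
  have "incseq (\<lambda>n. real n ^ 2 * fps_nth (rank_gf 0) n)"
  proof (rule incseq_SucI)
    fix n
    show "real n ^ 2 * fps_nth (rank_gf 0) n \<le> real (Suc n) ^ 2 * fps_nth (rank_gf 0) (Suc n)"
    proof (cases "n = 0")
      case False
      \<comment> \<open>The difference of the two sides is (n - 1)/2.\<close>
      then have "real n ^ 2 \<le> real (Suc n) * (real n - 1 / 2)"
        by (cases n) (auto simp: field_simps power2_eq_square)
      then have "real n ^ 2 * fps_nth (rank_gf 0) n
          \<le> real (Suc n) * (real n - 1 / 2) * fps_nth (rank_gf 0) n"
        by (rule mult_right_mono) simp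
      also have "\<dots> = real (Suc n) * (real (Suc n) * fps_nth (rank_gf 0) (Suc n))"
        using False by (simp only: rank_gf_0_nth_Suc mult.assoc if_False)
      finally show ?thesis by (simp only: power2_eq_square mult.assoc)
    qed simp
  qed
  then show "real m ^ 2 * fps_nth (rank_gf 0) m \<le> real n ^ 2 * fps_nth (rank_gf 0) n"
    if "m \<le> n" for m n
    using that by (rule incseqD)
  have "(\<lambda>n. real (Suc n) / (real n - 1 / 2)) \<longlonglongrightarrow> 1"
    by real_asymp
  moreover have "\<forall>\<^sub>F n in sequentially. real (Suc n) / (real n - 1 / 2) =
      fps_nth (rank_gf 0) n / fps_nth (rank_gf 0) (Suc n)"
    using eventually_gt_at_top[of "0::nat"]
  proof eventually_elim
    case (elim n)
    then show ?case
      using rank_gf_0_nth_Suc[of n] rank_gf_0_pos[of "Suc n"] by (simp add: field_simps)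
  qed
  ultimately show "(\<lambda>n. fps_nth (rank_gf 0) n / fps_nth (rank_gf 0) (Suc n)) \<longlonglongrightarrow> 1"
    by (rule Lim_transform_eventually)
qed

lemma dominated_rank_gf: "rank_gf.dominated 1 (rank_gf k)"
  by (simp add: rank_gf.dominated_def rank_gf_le_0)

lemmas summable_rank_gf = rank_gf.dominated_summable[OF dominated_rank_gf]

section \<open>Values of the generating functions at the singularity\<close>

lemma
  shows summable_X_plus_rank_gf: "summable (fps_nth (fps_const (1/4) * fps_X + rank_gf k))"
    and fps_total_X_plus_rank_gf:
      "fps_total (fps_const (1/4) * fps_X + rank_gf k) = 1 / 4 + fps_total (rank_gf k)"
proof -
  have "(\<lambda>n. (if n = 1 then 1 / 4 else 0) + fps_nth (rank_gf k) n) sums (1 / 4 + fps_total (rank_gf k))"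
    unfolding fps_total_def
    by (intro sums_add summable_sums[OF summable_rank_gf]) (rule sums_single)
  moreover have "(\<lambda>n. (if n = 1 then 1 / 4 else 0) + fps_nth (rank_gf k) n) =
      fps_nth (fps_const (1/4) * fps_X + rank_gf k)"
    by (rule ext) simp
  ultimately have "fps_nth (fps_const (1/4) * fps_X + rank_gf k) sums (1 / 4 + fps_total (rank_gf k))"
    by simp
  then show "summable (fps_nth (fps_const (1/4) * fps_X + rank_gf k))"
    "fps_total (fps_const (1/4) * fps_X + rank_gf k) = 1 / 4 + fps_total (rank_gf k)"
    by (simp_all only: sums_iff fps_total_def)
qed

lemma fps_total_rank_gf_Suc:
  "fps_total (rank_gf (Suc k)) = fps_total (rank_gf k) * (1 / 4 + fps_total (rank_gf (Suc k)))"
  using fps_total_mult[OF rank_gf_nonneg summable_rank_gf _ summable_X_plus_rank_gf, of "Suc k" k]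
  unfolding rank_gf_Suc[symmetric] fps_total_X_plus_rank_gf by simp

lemma fps_total_rank_gf: "fps_total (rank_gf k) = 3 / (2 * (2 + 4 ^ k))"
proof (induction k)
  case 0
  have "fps_total (rank_gf 0) = 1 / 4 + fps_total (rank_gf 0) * fps_total (rank_gf 0)"
    using fps_total_X_plus_rank_gf[of 1] fps_total_rank_gf_Suc[of 0]
    unfolding rank_gf_0[symmetric] by simp
  \<comment> \<open>The quadratic has a double root here, so no branch has to be chosen.\<close>
  then have "(fps_total (rank_gf 0) - 1 / 2) ^ 2 = 0"
    by (simp add: power2_eq_square algebra_simps)
  then show ?case by simp
next
  case (Suc k)
  have "(2 + 4 ^ k :: real) > 0"
    by (simp add: add_pos_pos)
  \<comment> \<open>The functional equation is linear in the new value.\<close>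
  then have "fps_total (rank_gf (Suc k)) * (8 * 4 ^ k + 4) = 3"
    using fps_total_rank_gf_Suc[of k] unfolding Suc by (simp add: field_simps)
  moreover have "(8 * 4 ^ k + 4 :: real) > 0"
    by (simp add: add_pos_pos)
  ultimately show ?case
    by (simp add: field_simps)
qed

lemma fps_total_rank_gf_le: "fps_total (rank_gf k) \<le> 1 / 2"
proof -
  have "(1::real) \<le> 4 ^ k" by simp
  then show ?thesis by (simp add: fps_total_rank_gf divide_simps add_pos_pos)
qed

text \<open>Serves both dominated convergences: over the powers of one \<open>rank_gf k\<close>,
  and, with \<open>k = 0\<close>, over the ranks.\<close>

lemma rank_gf_power_le:
  "fps_nth (rank_gf k ^ Suc m) n \<le> (real m + 1) ^ 3 * (1 / 2) ^ m * fps_nth (rank_gf 0) n"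
proof -
  have "fps_nth (rank_gf k ^ Suc m) n \<le>
      1 * (real m + 1) ^ 3 * fps_total (rank_gf k) ^ m * fps_nth (rank_gf 0) n"
    by (rule rank_gf.dominatedD[OF rank_gf.dominated_power[OF dominated_rank_gf]])
  also have "\<dots> \<le> 1 * (real m + 1) ^ 3 * (1 / 2) ^ m * fps_nth (rank_gf 0) n"
    by (intro mult_right_mono mult_left_mono power_mono fps_total_rank_gf_le
        rank_gf.fps_total_nonneg[OF dominated_rank_gf]) auto
  finally show ?thesis by simp
qed

lemma summable_cube_half_power: "summable (\<lambda>m. (real m + 1) ^ 3 * (1 / 2) ^ m)"
proof (rule summable_comparison_test_bigo)
  show "summable (\<lambda>m. norm ((3 / 4 :: real) ^ m))"
    by (simp add: summable_geometric)
  show "(\<lambda>m. (real m + 1) ^ 3 * (1 / 2) ^ m) \<in> O(\<lambda>m. (3 / 4) ^ m)"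
    by real_asymp
qed

text \<open>Iterating the functional equation is a finite substitute for dividing by
  \<open>1 - rank_gf k\<close>.\<close>

lemma rank_gf_Suc_geometric:
  "rank_gf (Suc k) = fps_const (1/4) * fps_X * (\<Sum>j<N. rank_gf k ^ Suc j)
     + rank_gf k ^ N * rank_gf (Suc k)"
proof (induction N)
  case (Suc N)
  have "rank_gf k ^ N * rank_gf (Suc k) =
      rank_gf k ^ N * (rank_gf k * (fps_const (1/4) * fps_X + rank_gf (Suc k)))"
    by (rule arg_cong[OF rank_gf_Suc])
  then show ?case
    by (subst Suc) (simp add: algebra_simps)
qed simp

lemma rank_gf_Suc_nth_Suc:
  "fps_nth (rank_gf (Suc k)) (Suc n) = (\<Sum>j. fps_nth (rank_gf k ^ Suc j) n) / 4"
proof -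
  have 0: "fps_nth (rank_gf k ^ m) i = 0" if "i < m" for i m
    using startsby_zero_power_prefix[of "rank_gf k" m] that by simp
  \<comment> \<open>The remainder does not reach index \<open>Suc n\<close>: the power has order at
    least \<open>Suc n\<close>, and the other factor has zero constant term.\<close>
  have "fps_nth (rank_gf k ^ Suc n * rank_gf (Suc k)) (Suc n) =
      (\<Sum>i\<le>Suc n. fps_nth (rank_gf k ^ Suc n) i * fps_nth (rank_gf (Suc k)) (Suc n - i))"
    by (simp only: fps_mult_nth atLeast0AtMost)
  also have "\<dots> = 0"
  proof (rule sum.neutral, intro ballI)
    fix i assume "i \<in> {..Suc n}"
    then show "fps_nth (rank_gf k ^ Suc n) i * fps_nth (rank_gf (Suc k)) (Suc n - i) = 0"
      using 0[of i "Suc n"] by (cases "i = Suc n") (simp_all del: power_Suc)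
  qed
  finally have "fps_nth (rank_gf (Suc k)) (Suc n) =
      fps_nth (fps_const (1/4) * fps_X * (\<Sum>j<Suc n. rank_gf k ^ Suc j)) (Suc n)"
    by (subst rank_gf_Suc_geometric[of _ "Suc n"]) (simp only: fps_add_nth add_0_right)
  also have "\<dots> = (\<Sum>j<Suc n. fps_nth (rank_gf k ^ Suc j) n) / 4"
    by (simp add: mult.assoc fps_sum_nth del: power_Suc sum.lessThan_Suc)
  also have "(\<Sum>j<Suc n. fps_nth (rank_gf k ^ Suc j) n) = (\<Sum>j. fps_nth (rank_gf k ^ Suc j) n)"
    by (rule suminf_finite[symmetric]) (simp_all add: 0 del: power_Suc)
  finally show ?thesis .
qed

lemma rank_gf_nth_ratio_tendsto:
  "(\<lambda>n. fps_nth (rank_gf k) n / fps_nth (rank_gf 0) n) \<longlonglongrightarrow> 9 * 4 ^ k / (2 + 4 ^ k) ^ 2"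
proof (induction k)
  case 0
  have "\<forall>\<^sub>F n in sequentially. fps_nth (rank_gf 0) n / fps_nth (rank_gf 0) n = 1"
    using eventually_gt_at_top[of "0::nat"]
    by eventually_elim (simp add: less_imp_neq[OF rank_gf_0_pos, symmetric])
  then show ?case by (intro tendsto_eventually) simp
next
  case (Suc k)
  let ?w = "fps_nth (rank_gf 0)"
  define S where "S = fps_total (rank_gf k)"
  define c :: real where "c = 9 * 4 ^ k / (2 + 4 ^ k) ^ 2"
  define p :: real where "p = 4 ^ k"
  have S: "0 \<le> S" "S \<le> 1 / 2"
    using rank_gf.fps_total_nonneg[OF dominated_rank_gf] fps_total_rank_gf_le by (simp_all add: S_def)
  have "(\<lambda>n. fps_nth (rank_gf k ^ Suc j) n / ?w n) \<longlonglongrightarrow> real (Suc j) * S ^ j * c" for j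
    unfolding S_def c_def by (rule rank_gf.power_tendsto[OF dominated_rank_gf Suc])
  moreover have "\<forall>\<^sub>F (j, n) in at_top \<times>\<^sub>F sequentially.
      norm (fps_nth (rank_gf k ^ Suc j) n / ?w n) \<le> (real j + 1) ^ 3 * (1 / 2) ^ j"
  proof (intro always_eventually allI, clarify)
    fix j n
    show "norm (fps_nth (rank_gf k ^ Suc j) n / ?w n) \<le> (real j + 1) ^ 3 * (1 / 2) ^ j"
    \<comment> \<open>At \<open>n = 0\<close> the quotient is 0, being a division by
      \<open>?w 0 = 0\<close>.\<close>
    proof (cases "n = 0")
      case False
      have "0 \<le> fps_nth (rank_gf k ^ Suc j) n"
        by (rule fps_power_nth_nonneg) simp
      then show ?thesis
        using rank_gf_power_le[of k j n] rank_gf_0_pos[of n] False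
        by (simp add: divide_le_eq del: power_Suc)
    qed simp
  qed
  ultimately have "(\<lambda>n. \<Sum>j. fps_nth (rank_gf k ^ Suc j) n / ?w n) \<longlonglongrightarrow>
      (\<Sum>j. real (Suc j) * S ^ j * c)"
    using summable_cube_half_power by (intro conjunct2[OF conjunct2[OF tannerys_theorem]]) auto
  also have "(\<Sum>j. real (Suc j) * S ^ j * c) = 1 / (1 - S) ^ 2 * c"
    using sums_mult2[OF geometric_deriv_sums[of S], of c] S by (simp add: sums_iff)
  \<comment> \<open>The root vertex shifts the index by one; the last factor, tending to 1, trades
    \<open>?w n\<close> for \<open>?w (Suc n)\<close>.\<close>
  finally have "(\<lambda>n. (\<Sum>j. fps_nth (rank_gf k ^ Suc j) n / ?w n) / 4 * (?w n / ?w (Suc n)))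
      \<longlonglongrightarrow> 1 / (1 - S) ^ 2 * c / 4 * 1"
    by (intro tendsto_intros rank_gf.w_ratio) simp_all
  moreover have "\<forall>\<^sub>F n in sequentially.
      (\<Sum>j. fps_nth (rank_gf k ^ Suc j) n / ?w n) / 4 * (?w n / ?w (Suc n)) =
      fps_nth (rank_gf (Suc k)) (Suc n) / ?w (Suc n)"
    using eventually_gt_at_top[of "0::nat"]
  proof eventually_elim
    case (elim n)
    have "summable (\<lambda>j. fps_nth (rank_gf k ^ Suc j) n)"
      by (rule summable_finite[of "{..n}"])
        (use startsby_zero_power_prefix[of "rank_gf k"] in \<open>simp_all del: power_Suc\<close>)
    then show ?case
      using rank_gf_0_pos[OF elim] by (simp add: rank_gf_Suc_nth_Suc suminf_divide del: power_Suc)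
  qed
  ultimately have "(\<lambda>n. fps_nth (rank_gf (Suc k)) (Suc n) / ?w (Suc n))
      \<longlonglongrightarrow> 1 / (1 - S) ^ 2 * c / 4 * 1"
    by (rule Lim_transform_eventually)
  \<comment> \<open>The factor (2 + p)^2 from 1 - S cancels the denominator of \<open>c\<close>, and
    2 (2p + 1) is 2 + \<open>4 ^ Suc k\<close>.\<close>
  moreover have "1 / (1 - S) ^ 2 * c / 4 * 1 = 9 * 4 ^ Suc k / (2 + 4 ^ Suc k) ^ 2"
  proof -
    have p: "p > 0" "2 + p > 0" "2 * p + 1 > 0" "4 * p + 2 > 0" by (simp_all add: p_def add_pos_pos)
    have "1 - S = (2 * p + 1) / (2 * (2 + p))"
      using p by (simp add: S_def fps_total_rank_gf p_def[symmetric] field_simps)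
    then have "1 / (1 - S) ^ 2 = 4 * (2 + p)\<^sup>2 / (2 * p + 1)\<^sup>2"
      by (simp only: power_divide power_mult_distrib) simp
    then have "1 / (1 - S) ^ 2 * c / 4 = (4 * (2 + p)\<^sup>2 / (2 * p + 1)\<^sup>2) * (9 * p / (2 + p)\<^sup>2) / 4"
      by (simp only: c_def p_def)
    also have "\<dots> = 36 * p / (2 * (2 * p + 1))\<^sup>2"
      by (simp only: power_mult_distrib) (use p in simp)
    finally show ?thesis
      by (simp add: p_def algebra_simps)
  qed
  ultimately have "(\<lambda>n. fps_nth (rank_gf (Suc k)) (Suc n) / ?w (Suc n))
      \<longlonglongrightarrow> 9 * 4 ^ Suc k / (2 + 4 ^ Suc k) ^ 2"
    by (simp only:)
  then show ?case
    by (rule LIMSEQ_imp_Suc)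
qed

text \<open>
  Along the leftmost branch a tree of rank at least \<open>k\<close> decomposes into \<open>k + 1\<close> arbitrary trees.
\<close>

lemma rank_gf_le_power: "fps_nth (rank_gf k) n \<le> fps_nth (rank_gf 0 ^ Suc k) n"
proof (induction k arbitrary: n)
  case (Suc k)
  have "fps_nth (rank_gf k * (fps_const (1/4) * fps_X + rank_gf (Suc k))) n \<le>
      fps_nth (rank_gf 0 ^ Suc k * rank_gf 0) n"
  proof (rule fps_mult_nth_mono)
    fix m
    show "0 \<le> fps_nth (fps_const (1/4) * fps_X + rank_gf (Suc k)) m" by simp
    \<comment> \<open>Weakening the rank condition to at least 1 lets \<open>rank_gf 0\<close> bound
      the whole second factor.\<close>
    have "trees_of_rank_ge (Suc k) m \<subseteq> trees_of_rank_ge 1 m"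
      by (auto simp: trees_of_rank_ge_def)
    then have "fps_nth (rank_gf (Suc k)) m \<le> fps_nth (rank_gf 1) m"
      by (simp add: rank_gf_nth card_mono[OF finite_trees_of_rank_ge] divide_right_mono)
    then show "fps_nth (fps_const (1/4) * fps_X + rank_gf (Suc k)) m \<le> fps_nth (rank_gf 0) m"
      by (subst rank_gf_0) simp
  qed (use Suc in simp_all)
  then show ?case
    unfolding rank_gf_Suc[symmetric] by (simp only: power_Suc2)
qed simp

section \<open>The expected rank and the numerical value of its limit\<close>

lemma expected_root_rank_eq:
  assumes "0 < n"
  shows "expected_root_rank n = (\<Sum>k. fps_nth (rank_gf (Suc k)) n / fps_nth (rank_gf 0) n)"
proof -
  have ne: "trees_of_size n \<noteq> {}"
    using rank_gf_0_pos[OF assms] by (auto simp: rank_gf_nth trees_of_rank_ge_0)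
  \<comment> \<open>Tail-sum formula: a rank is the number of levels \<open>Suc k\<close> it
    reaches, and \<open>n\<close> levels suffice because ranks stay below \<open>n\<close>.\<close>
  have rank: "real (root_rank t) = (\<Sum>k<n. if Suc k \<le> root_rank t then 1 else 0)"
    if "t \<in> trees_of_size n" for t
  proof -
    have "root_rank t < n"
      using less_num_vertices[of "root_rank t" t] that by (simp add: trees_of_size_def)
    then have "{..<n} \<inter> {k. Suc k \<le> root_rank t} = {..<root_rank t}"
      by auto
    then show ?thesis
      by (simp add: sum.If_cases)
  qed
  have "(\<Sum>t\<in>trees_of_size n. real (root_rank t)) =
      (\<Sum>t\<in>trees_of_size n. \<Sum>k<n. if Suc k \<le> root_rank t then 1 else 0)"
    using rank by (rule sum.cong[OF refl])
  also have "\<dots> = (\<Sum>k<n. \<Sum>t\<in>trees_of_size n. if Suc k \<le> root_rank t then 1 else 0)"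
    by (rule sum.swap)
  also have "\<dots> = (\<Sum>k<n. real (card (trees_of_rank_ge (Suc k) n)))"
  proof (rule sum.cong)
    fix k
    have "trees_of_size n \<inter> {t. Suc k \<le> root_rank t} = trees_of_rank_ge (Suc k) n"
      by (auto simp: trees_of_size_def trees_of_rank_ge_def)
    then show "(\<Sum>t\<in>trees_of_size n. if Suc k \<le> root_rank t then 1 else 0) =
        real (card (trees_of_rank_ge (Suc k) n))"
      by (simp add: sum.If_cases finite_trees_of_size)
  qed simp
  finally have "expected_root_rank n =
      (\<Sum>k<n. fps_nth (rank_gf (Suc k)) n / fps_nth (rank_gf 0) n)"
    by (simp add: expected_root_rank_def integral_pmf_of_set ne finite_trees_of_size
        rank_gf_nth trees_of_rank_ge_0 sum_divide_distrib)
  \<comment> \<open>The added terms vanish; dominated convergence needs a range independent of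
    \<open>n\<close>.\<close>
  also have "\<dots> = (\<Sum>k. fps_nth (rank_gf (Suc k)) n / fps_nth (rank_gf 0) n)"
  proof (rule suminf_finite[symmetric])
    fix k assume "k \<notin> {..<n}"
    then have "trees_of_rank_ge (Suc k) n = {}"
      using less_num_vertices[of "Suc k"] by (force simp: trees_of_rank_ge_def)
    then show "fps_nth (rank_gf (Suc k)) n / fps_nth (rank_gf 0) n = 0"
      by (simp add: rank_gf_nth)
  qed simp
  finally show ?thesis .
qed

text \<open>Multiplying the denominator by \<open>4 ^ Suc k\<close> makes it a perfect square, which
  identifies the limits of the coefficient ratios with the terms of the series.\<close>

lemma rank_series_term_Suc: "rank_series_term (Suc k) = 9 * 4 ^ Suc k / (2 + 4 ^ Suc k) ^ 2"
proof -
  define p :: real where "p = 4 ^ k"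
  have p: "p > 0"
    by (simp add: p_def)
  have "(4::real) powi (1 - int (Suc k)) = 1 / p"
    by (simp add: p_def power_int_minus power_int_of_nat inverse_eq_divide)
  then have "rank_series_term (Suc k) = 9 / (1 / p + 4 + 4 * p)"
    by (simp add: rank_series_term_def p_def)
  also have "1 / p + 4 + 4 * p = (2 + 4 * p) ^ 2 / (4 * p)"
    using p by (simp add: field_simps power2_eq_square)
  finally show ?thesis
    by (simp add: p_def)
qed

text \<open>Tannery's theorem exchanges the limit with the sum over ranks and also delivers
  summability of the limits.\<close>

lemma expected_root_rank_tendsto:
  "summable (\<lambda>k. rank_series_term (Suc k))"
  "expected_root_rank \<longlonglongrightarrow> (\<Sum>k. rank_series_term (Suc k))"
proof -
  let ?a = "\<lambda>k n. fps_nth (rank_gf (Suc k)) n / fps_nth (rank_gf 0) n"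
  have lim: "?a k \<longlonglongrightarrow> rank_series_term (Suc k)" for k
    unfolding rank_series_term_Suc by (rule rank_gf_nth_ratio_tendsto)
  have bound: "\<forall>\<^sub>F (k, n) in at_top \<times>\<^sub>F sequentially.
      norm (?a k n) \<le> (real (Suc k) + 1) ^ 3 * (1 / 2) ^ Suc k"
  proof (intro always_eventually allI, clarify)
    fix k n
    show "norm (?a k n) \<le> (real (Suc k) + 1) ^ 3 * (1 / 2) ^ Suc k"
    proof (cases "n = 0")
      case False
      have "fps_nth (rank_gf (Suc k)) n \<le>
          (real (Suc k) + 1) ^ 3 * (1 / 2) ^ Suc k * fps_nth (rank_gf 0) n"
        by (rule order_trans[OF rank_gf_le_power rank_gf_power_le])
      then show ?thesis
        using rank_gf_0_pos[of n] False by (simp add: divide_le_eq)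
    qed simp
  qed
  have "summable (\<lambda>k. (real (Suc k) + 1) ^ 3 * (1 / 2) ^ Suc k)"
    using summable_cube_half_power by (subst summable_Suc_iff)
  note tannery = tannerys_theorem[OF lim bound this sequentially_bot]
  from tannery have "summable (\<lambda>k. norm (rank_series_term (Suc k)))" by blast
  then show "summable (\<lambda>k. rank_series_term (Suc k))"
    by (rule summable_norm_cancel)
  from tannery have "(\<lambda>n. \<Sum>k. ?a k n) \<longlonglongrightarrow> (\<Sum>k. rank_series_term (Suc k))" by blast
  moreover have "\<forall>\<^sub>F n in sequentially. (\<Sum>k. ?a k n) = expected_root_rank n"
    using eventually_gt_at_top[of "0::nat"]
    by eventually_elim (simp add: expected_root_rank_eq)
  ultimately show "expected_root_rank \<longlonglongrightarrow> (\<Sum>k. rank_series_term (Suc k))"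
    by (rule Lim_transform_eventually)
qed

text \<open>Ten terms are evaluated exactly. Keeping only the largest power of 4 in each later
  denominator bounds the tail by 9/4^11 * 4/3 < 0.000003.\<close>

lemma rank_series_bounds:
  "1.622968 < (\<Sum>k. rank_series_term (Suc k))" "(\<Sum>k. rank_series_term (Suc k)) < 1.622973"
proof -
  let ?r = "\<lambda>k. rank_series_term (Suc k)"
  have nonneg: "0 \<le> ?r k" for k
    unfolding rank_series_term_Suc by simp
  have le: "?r (k + 10) \<le> 9 / 4 ^ 11 * (1 / 4) ^ k" for k
  proof -
    have "0 \<le> (4::real) powi (1 - int (k + 11))" by simp
    then have "9 / (4 powi (1 - int (k + 11)) + 4 + 4 ^ (k + 11)) \<le> 9 / (4::real) ^ (k + 11)"
      by (intro frac_le) simp_all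
    then have "?r (k + 10) \<le> 9 / 4 ^ (k + 11)"
      by (simp only: rank_series_term_def add_Suc_right[symmetric] eval_nat_numeral)
    then show ?thesis by (simp add: power_add power_divide mult_ac)
  qed
  have geo: "(\<lambda>k. 9 / 4 ^ 11 * (1 / 4) ^ k) sums (9 / 4 ^ 11 * (1 / (1 - 1 / 4 :: real)))"
    by (intro sums_mult geometric_sums) simp
  have "summable (\<lambda>k. ?r (k + 10))"
    using expected_root_rank_tendsto(1) by (subst summable_iff_shift)
  then have "0 \<le> (\<Sum>k. ?r (k + 10))"
      "(\<Sum>k. ?r (k + 10)) \<le> (\<Sum>k. 9 / 4 ^ 11 * (1 / 4) ^ k)"
    by (rule suminf_nonneg[OF _ nonneg] suminf_le[OF le _ sums_summable[OF geo]])+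
  then have "0 \<le> (\<Sum>k. ?r (k + 10))" "(\<Sum>k. ?r (k + 10)) \<le> 9 / 4 ^ 11 * (1 / (1 - 1 / 4))"
    by (simp_all only: sums_unique[OF geo])
  moreover have "(\<Sum>k. ?r k) = (\<Sum>k. ?r (k + 10)) + (\<Sum>k<10. ?r k)"
    by (rule suminf_split_initial_segment[OF expected_root_rank_tendsto(1)])
  moreover have "1.622968 < (\<Sum>k<10. ?r k)" "(\<Sum>k<10. ?r k) < 1.622969"
    by (simp_all add: rank_series_term_Suc eval_nat_numeral)
  ultimately show "1.622968 < (\<Sum>k. ?r k)" "(\<Sum>k. ?r k) < 1.622973"
    by simp_all
qed

theorem theorem4p1:
  "summable (\<lambda>k. rank_series_term (Suc k)) \<and>
   expected_root_rank \<sim>[sequentially] (\<lambda>_. \<Sum>k. rank_series_term (Suc k)) \<and>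
   \<bar>(\<Sum>k. rank_series_term (Suc k)) - 1.62297\<bar> < 0.000005"
proof (intro conjI)
  show "summable (\<lambda>k. rank_series_term (Suc k))"
    by (rule expected_root_rank_tendsto)
  show "expected_root_rank \<sim>[sequentially] (\<lambda>_. \<Sum>k. rank_series_term (Suc k))"
    \<comment> \<open>Equivalence to a constant needs a nonzero limit, which the lower bound
      supplies.\<close>
    using rank_series_bounds by (intro tendsto_imp_asymp_equiv_const expected_root_rank_tendsto) auto
  show "\<bar>(\<Sum>k. rank_series_term (Suc k)) - 1.62297\<bar> < 0.000005"
    unfolding abs_less_iff using rank_series_bounds by simp
qed

end
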